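(* Let $(X,\mu,\mathcal{E},\mathcal{F})$ be a Dirichlet space with conservative heat semigroup $\{P_t\}_{t\in[0,\infty)}$, and let $\alpha\ge0$. If $1\le q\le p<\infty$ and $\mathbf B^{p,\alpha}(X)$ is dense in $L^p(X,\mu)$, then $\mathbf B^{q,\alpha}(X)$ is dense in $L^q(X,\mu)$. Hence $\mathbf B^{p,1/2}(X)$ is dense in $L^p(X,\mu)$ for $1\le p\le2$.
   Context: $X$ is a good measurable space (the measure decomposition theorem holds and the $\sigma$-algebra is generated by a countable family; e.g. a Polish space) with a $\sigma$-finite measure $\mu$. A Dirichlet form is a densely defined closed symmetric form $(\mathcal{E},\mathcal{F})$ on $L^2(X,\mu)$ which is Markovian: if $u\in\mathcal F$ and $v$ satisfies $|v(x)-v(y)|\le|u(x)-u(y)|$ and $|v(x)|\le|u(x)|$ for a.e. $x,y$, then $v\in\mathcal F$ and $\mathcal E(v,v)\le\mathcal E(u,u)$. Then $(X,\mu,\mathcal E,\mathcal F)$ is called a Dirichlet space. $\{P_t\}_{t\ge0}$ is the associated self-adjoint sub-Markovian semigroup on $L^2(X,\mu)$ (the heat semigroup), extended to a contraction semigroup on every $L^p(X,\mu)$, $1\le p\le\infty$. It is conservative if $P_t1=1$ for all $t$; then there are probability kernels $p_t(x,dy)$ with $P_tf(x)=\int_Xf(y)\,p_t(x,dy)$ for bounded or non-negative measurable $f$. For $p\ge1$, $\alpha\ge0$, $f\in L^p(X,\mu)$, $$\|f\|_{p,\alpha}=\sup_{t>0}t^{-\alpha}\left(\int_X\int_X|f(x)-f(y)|^p\,p_t(y,dx)\,d\mu(y)\right)^{1/p},$$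 and $\mathbf B^{p,\alpha}(X)=\{f\in L^p(X,\mu):\|f\|_{p,\alpha}<+\infty\}$. *)

theory Defs
  imports "HOL-Probability.Probability"
begin

section \<open>Lebesgue spaces\<close>

text \<open>Elements of \<open>L\<^sup>p\<close> are represented by measurable real functions; equality in \<open>L\<^sup>p\<close> is
  equality almost everywhere, and every notion below is invariant under it.\<close>

definition Lp :: "'a measure \<Rightarrow> real \<Rightarrow> ('a \<Rightarrow> real) set" where
  "Lp M p = {f \<in> borel_measurable M. integrable M (\<lambda>x. \<bar>f x\<bar> powr p)}"

definition Lp_norm :: "'a measure \<Rightarrow> real \<Rightarrow> ('a \<Rightarrow> real) \<Rightarrow> real" where
  "Lp_norm M p f = (\<integral>x. \<bar>f x\<bar> powr p \<partial>M) powr (1 / p)"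

definition Linf :: "'a measure \<Rightarrow> ('a \<Rightarrow> real) set" where
  "Linf M = {f \<in> borel_measurable M. \<exists>C. AE x in M. \<bar>f x\<bar> \<le> C}"

definition dense_in_Lp :: "'a measure \<Rightarrow> real \<Rightarrow> ('a \<Rightarrow> real) set \<Rightarrow> bool" where
  "dense_in_Lp M p S \<longleftrightarrow> S \<subseteq> Lp M p \<and>
     (\<forall>f\<in>Lp M p. \<forall>\<epsilon>>0. \<exists>g\<in>S. Lp_norm M p (\<lambda>x. f x - g x) < \<epsilon>)"

section \<open>Dirichlet spaces\<close>

text \<open>The second conjunct is the measure decomposition theorem: every probability measure on the
  product disintegrates along its first marginal.\<close>

definition good_measurable_space :: "'a measure \<Rightarrow> bool" where
  "good_measurable_space M \<longleftrightarrow>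
     (\<exists>C. countable C \<and> C \<subseteq> Pow (space M) \<and> sets M = sigma_sets (space M) C) \<and>
     (\<forall>N::('a \<times> 'a) measure. prob_space N \<and> sets N = sets (M \<Otimes>\<^sub>M M) \<longrightarrow>
        (\<exists>\<kappa> \<in> measurable M (prob_algebra M). \<forall>A\<in>sets M. \<forall>B\<in>sets M.
           emeasure N (A \<times> B) = (\<integral>\<^sup>+x\<in>A. emeasure (\<kappa> x) B \<partial>distr N M fst)))"

text \<open>A form \<open>\<E>\<close> is a total function whose values matter only on its domain \<open>\<F>\<close>.\<close>

definition symmetric_form ::
  "'a measure \<Rightarrow> (('a \<Rightarrow> real) \<Rightarrow> ('a \<Rightarrow> real) \<Rightarrow> real) \<Rightarrow> ('a \<Rightarrow> real) set \<Rightarrow> bool" where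
  "symmetric_form M \<E> \<F> \<longleftrightarrow>
     \<F> \<subseteq> Lp M 2 \<and>
     (\<forall>u\<in>\<F>. \<forall>v\<in>borel_measurable M. (AE x in M. u x = v x) \<longrightarrow>
        v \<in> \<F> \<and> (\<forall>w\<in>\<F>. \<E> u w = \<E> v w)) \<and>
     (\<lambda>x. 0) \<in> \<F> \<and>
     (\<forall>u\<in>\<F>. \<forall>v\<in>\<F>. \<forall>a b. (\<lambda>x. a * u x + b * v x) \<in> \<F> \<and>
        (\<forall>w\<in>\<F>. \<E> (\<lambda>x. a * u x + b * v x) w = a * \<E> u w + b * \<E> v w)) \<and>
     (\<forall>u\<in>\<F>. \<forall>v\<in>\<F>. \<E> u v = \<E> v u) \<and>
     (\<forall>u\<in>\<F>. \<E> u u \<ge> 0)"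

definition form_norm_sq ::
  "'a measure \<Rightarrow> (('a \<Rightarrow> real) \<Rightarrow> ('a \<Rightarrow> real) \<Rightarrow> real) \<Rightarrow> ('a \<Rightarrow> real) \<Rightarrow> real" where
  "form_norm_sq M \<E> u = \<E> u u + (\<integral>x. (u x)\<^sup>2 \<partial>M)"

definition closed_form ::
  "'a measure \<Rightarrow> (('a \<Rightarrow> real) \<Rightarrow> ('a \<Rightarrow> real) \<Rightarrow> real) \<Rightarrow> ('a \<Rightarrow> real) set \<Rightarrow> bool" where
  "closed_form M \<E> \<F> \<longleftrightarrow>
     (\<forall>u::nat \<Rightarrow> 'a \<Rightarrow> real. (\<forall>n. u n \<in> \<F>) \<and>
        (\<forall>\<epsilon>>0. \<exists>N. \<forall>m\<ge>N. \<forall>n\<ge>N. form_norm_sq M \<E> (\<lambda>x. u m x - u n x) < \<epsilon>) \<longrightarrow>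
        (\<exists>v\<in>\<F>. (\<lambda>n. form_norm_sq M \<E> (\<lambda>x. u n x - v x)) \<longlonglongrightarrow> 0))"

definition markovian_form ::
  "'a measure \<Rightarrow> (('a \<Rightarrow> real) \<Rightarrow> ('a \<Rightarrow> real) \<Rightarrow> real) \<Rightarrow> ('a \<Rightarrow> real) set \<Rightarrow> bool" where
  "markovian_form M \<E> \<F> \<longleftrightarrow>
     (\<forall>u\<in>\<F>. \<forall>v\<in>borel_measurable M.
        (AE (x, y) in M \<Otimes>\<^sub>M M. \<bar>v x - v y\<bar> \<le> \<bar>u x - u y\<bar>) \<and>
        (AE x in M. \<bar>v x\<bar> \<le> \<bar>u x\<bar>) \<longrightarrow>
        v \<in> \<F> \<and> \<E> v v \<le> \<E> u u)"

definition dirichlet_form ::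
  "'a measure \<Rightarrow> (('a \<Rightarrow> real) \<Rightarrow> ('a \<Rightarrow> real) \<Rightarrow> real) \<Rightarrow> ('a \<Rightarrow> real) set \<Rightarrow> bool" where
  "dirichlet_form M \<E> \<F> \<longleftrightarrow> symmetric_form M \<E> \<F> \<and> dense_in_Lp M 2 \<F> \<and>
     closed_form M \<E> \<F> \<and> markovian_form M \<E> \<F>"

definition dirichlet_space ::
  "'a measure \<Rightarrow> (('a \<Rightarrow> real) \<Rightarrow> ('a \<Rightarrow> real) \<Rightarrow> real) \<Rightarrow> ('a \<Rightarrow> real) set \<Rightarrow> bool" where
  "dirichlet_space M \<E> \<F> \<longleftrightarrow>
     good_measurable_space M \<and> sigma_finite_measure M \<and> dirichlet_form M \<E> \<F>"

section \<open>The heat semigroup\<close>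

definition linear_semigroup_on ::
  "'a measure \<Rightarrow> ('a \<Rightarrow> real) set \<Rightarrow> (real \<Rightarrow> ('a \<Rightarrow> real) \<Rightarrow> 'a \<Rightarrow> real) \<Rightarrow> bool" where
  "linear_semigroup_on M V P \<longleftrightarrow>
     (\<forall>t\<ge>0. \<forall>f\<in>V. P t f \<in> V) \<and>
     (\<forall>t\<ge>0. \<forall>f\<in>V. \<forall>g\<in>V. \<forall>a b.
        AE x in M. P t (\<lambda>y. a * f y + b * g y) x = a * P t f x + b * P t g x) \<and>
     (\<forall>f\<in>V. AE x in M. P 0 f x = f x) \<and>
     (\<forall>s\<ge>0. \<forall>t\<ge>0. \<forall>f\<in>V. AE x in M. P (s + t) f x = P s (P t f) x)"

definition contraction_semigroup_Lp ::
  "'a measure \<Rightarrow> real \<Rightarrow> (real \<Rightarrow> ('a \<Rightarrow> real) \<Rightarrow> 'a \<Rightarrow> real) \<Rightarrow> bool" where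
  "contraction_semigroup_Lp M p P \<longleftrightarrow> linear_semigroup_on M (Lp M p) P \<and>
     (\<forall>t\<ge>0. \<forall>f\<in>Lp M p. Lp_norm M p (P t f) \<le> Lp_norm M p f)"

definition contraction_semigroup_Linf ::
  "'a measure \<Rightarrow> (real \<Rightarrow> ('a \<Rightarrow> real) \<Rightarrow> 'a \<Rightarrow> real) \<Rightarrow> bool" where
  "contraction_semigroup_Linf M P \<longleftrightarrow> linear_semigroup_on M (Linf M) P \<and>
     (\<forall>t\<ge>0. \<forall>f\<in>Linf M. \<forall>C. (AE x in M. \<bar>f x\<bar> \<le> C) \<longrightarrow> (AE x in M. \<bar>P t f x\<bar> \<le> C))"

text \<open>\<open>f = L u\<close> for the infinitesimal generator \<open>L\<close> of the semigroup \<open>P\<close> on \<open>L\<^sup>2\<close>.\<close>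

definition semigroup_generator ::
  "'a measure \<Rightarrow> (real \<Rightarrow> ('a \<Rightarrow> real) \<Rightarrow> 'a \<Rightarrow> real) \<Rightarrow> ('a \<Rightarrow> real) \<Rightarrow> ('a \<Rightarrow> real) \<Rightarrow> bool" where
  "semigroup_generator M P u f \<longleftrightarrow> u \<in> Lp M 2 \<and> f \<in> Lp M 2 \<and>
     ((\<lambda>t. Lp_norm M 2 (\<lambda>x. (P t u x - u x) / t - f x)) \<longlongrightarrow> 0) (at_right 0)"

text \<open>\<open>f = L u\<close> for the non-positive self-adjoint operator \<open>L\<close> on \<open>L\<^sup>2\<close> determined by the
  closed form, i.e. \<open>\<E> u v = - \<langle>L u, v\<rangle>\<close> for all \<open>v \<in> \<F>\<close>.\<close>

definition form_generator ::
  "'a measure \<Rightarrow> (('a \<Rightarrow> real) \<Rightarrow> ('a \<Rightarrow> real) \<Rightarrow> real) \<Rightarrow> ('a \<Rightarrow> real) set \<Rightarrow>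
    ('a \<Rightarrow> real) \<Rightarrow> ('a \<Rightarrow> real) \<Rightarrow> bool" where
  "form_generator M \<E> \<F> u f \<longleftrightarrow> u \<in> \<F> \<and> f \<in> Lp M 2 \<and>
     (\<forall>v\<in>\<F>. \<E> u v = - (\<integral>x. f x * v x \<partial>M))"

text \<open>\<open>P t f\<close> is a representative of the class of \<open>P\<^sub>t f\<close>, for \<open>f\<close> in any \<open>L\<^sup>p\<close>,
  \<open>1 \<le> p \<le> \<infinity>\<close>. On \<open>L\<^sup>2\<close>, \<open>P\<close> is the strongly continuous semigroup of self-adjoint
  sub-Markovian contractions whose generator is the one of the form. For finite \<open>p\<close> the extension
  is unique by density of \<open>L\<^sup>p \<inter> L\<^sup>2\<close>; on \<open>L\<^sup>\<infinity>\<close>, where \<open>L\<^sup>2 \<inter> L\<^sup>\<infinity>\<close> need not be dense, it is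
  the dual of the semigroup on \<open>L\<^sup>1\<close>, which the last conjunct expresses.\<close>

definition heat_semigroup ::
  "'a measure \<Rightarrow> (('a \<Rightarrow> real) \<Rightarrow> ('a \<Rightarrow> real) \<Rightarrow> real) \<Rightarrow> ('a \<Rightarrow> real) set \<Rightarrow>
    (real \<Rightarrow> ('a \<Rightarrow> real) \<Rightarrow> 'a \<Rightarrow> real) \<Rightarrow> bool" where
  "heat_semigroup M \<E> \<F> P \<longleftrightarrow>
     contraction_semigroup_Lp M 2 P \<and>
     (\<forall>f\<in>Lp M 2. ((\<lambda>t. Lp_norm M 2 (\<lambda>x. P t f x - f x)) \<longlongrightarrow> 0) (at_right 0)) \<and>
     (\<forall>t\<ge>0. \<forall>f\<in>Lp M 2. \<forall>g\<in>Lp M 2. (\<integral>x. P t f x * g x \<partial>M) = (\<integral>x. f x * P t g x \<partial>M)) \<and>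
     (\<forall>t\<ge>0. \<forall>f\<in>Lp M 2. (AE x in M. 0 \<le> f x \<and> f x \<le> 1) \<longrightarrow>
        (AE x in M. 0 \<le> P t f x \<and> P t f x \<le> 1)) \<and>
     (\<forall>u f. semigroup_generator M P u f \<longleftrightarrow> form_generator M \<E> \<F> u f) \<and>
     (\<forall>p\<ge>1. contraction_semigroup_Lp M p P) \<and>
     contraction_semigroup_Linf M P \<and>
     (\<forall>t\<ge>0. \<forall>f\<in>Linf M. \<forall>g\<in>Lp M 1. (\<integral>x. P t f x * g x \<partial>M) = (\<integral>x. f x * P t g x \<partial>M))"

definition conservative :: "'a measure \<Rightarrow> (real \<Rightarrow> ('a \<Rightarrow> real) \<Rightarrow> 'a \<Rightarrow> real) \<Rightarrow> bool" where
  "conservative M P \<longleftrightarrow> (\<forall>t\<ge>0. AE x in M. P t (\<lambda>y. 1) x = 1)"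

text \<open>\<open>\<kappa> t x\<close> is the probability measure \<open>p\<^sub>t(x, dy)\<close>. The kernels are determined by the
  semigroup up to a null set of points \<open>x\<close>, for each \<open>t\<close>. The second representation formula
  concerns the non-negative functions to which \<open>P\<close> already applies; for other non-negative
  measurable functions the formula serves as the definition of \<open>P\<^sub>t f\<close>.\<close>

definition heat_kernel ::
  "'a measure \<Rightarrow> (real \<Rightarrow> ('a \<Rightarrow> real) \<Rightarrow> 'a \<Rightarrow> real) \<Rightarrow> (real \<Rightarrow> 'a \<Rightarrow> 'a measure) \<Rightarrow> bool" where
  "heat_kernel M P \<kappa> \<longleftrightarrow> (\<forall>t\<ge>0. \<kappa> t \<in> measurable M (prob_algebra M) \<and>
     (\<forall>f\<in>borel_measurable M. (\<exists>C. \<forall>x\<in>space M. \<bar>f x\<bar> \<le> C) \<longrightarrow>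
        (AE x in M. P t f x = (\<integral>y. f y \<partial>\<kappa> t x))) \<and>
     (\<forall>p\<ge>1. \<forall>f\<in>Lp M p. (\<forall>x\<in>space M. 0 \<le> f x) \<longrightarrow>
        (AE x in M. ennreal (P t f x) = (\<integral>\<^sup>+y. ennreal (f y) \<partial>\<kappa> t x))))"

section \<open>Heat semigroup based Besov spaces\<close>

text \<open>Used for positive exponents only.\<close>

definition ennreal_powr :: "ennreal \<Rightarrow> real \<Rightarrow> ennreal" where
  "ennreal_powr z a = (if z = \<infinity> then \<infinity> else ennreal (enn2real z powr a))"

definition besov_seminorm ::
  "'a measure \<Rightarrow> (real \<Rightarrow> 'a \<Rightarrow> 'a measure) \<Rightarrow> real \<Rightarrow> real \<Rightarrow> ('a \<Rightarrow> real) \<Rightarrow> ennreal" where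
  "besov_seminorm M \<kappa> p \<alpha> f =
     (SUP t\<in>{0<..}. ennreal (t powr (- \<alpha>)) *
        ennreal_powr (\<integral>\<^sup>+y. (\<integral>\<^sup>+x. ennreal (\<bar>f x - f y\<bar> powr p) \<partial>\<kappa> t y) \<partial>M) (1 / p))"

definition besov_space ::
  "'a measure \<Rightarrow> (real \<Rightarrow> 'a \<Rightarrow> 'a measure) \<Rightarrow> real \<Rightarrow> real \<Rightarrow> ('a \<Rightarrow> real) set" where
  "besov_space M \<kappa> p \<alpha> = {f \<in> Lp M p. besov_seminorm M \<kappa> p \<alpha> f < \<infinity>}"

end

theory Submission
  imports Defs
begin

text \<open>For \<open>q \<le> p\<close> the map \<open>\<phi> f = sgn f \<bar>f\<bar>\<^bsup>p/q\<^esup>\<close> sends \<open>L\<^sup>p\<close> onto \<open>L\<^sup>q\<close>. It is controlled by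
  \<open>\<bar>\<phi> a - \<phi> b\<bar> \<le> (p/q) (\<bar>a\<bar> + \<bar>b\<bar>)\<^bsup>p/q - 1\<^esup> \<bar>a - b\<bar>\<close> followed by Young's inequality with a free
  scale \<open>l\<close>. Integrated over \<open>M\<close>, this shows that the map is continuous, hence preserves density;
  integrated against \<open>p\<^sub>t(y, dx) d\<mu>(y)\<close> with \<open>l = t\<^bsup>\<alpha>p\<^esup>\<close>, it shows that \<open>B\<^bsup>p,\<alpha>\<^esup>\<close> is mapped into
  \<open>B\<^bsup>q,\<alpha>\<^esup>\<close>.

  For \<open>p = 2\<close> and \<open>\<alpha> = 1/2\<close>, the functions \<open>P\<^sub>s g\<close> with \<open>s > 0\<close> are dense in \<open>L\<^sup>2\<close>. With
  \<open>\<psi>(t) = \<langle>P\<^sub>t g, g\<rangle>\<close>, the energy of \<open>u = P\<^sub>s g\<close> at time \<open>t\<close> is at most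
  \<open>2\<langle>u - P\<^sub>t u, u\<rangle> = 2(\<psi>(2s) - \<psi>(2s + t))\<close>, and \<open>\<psi>\<close> is non-negative, bounded by \<open>\<psi>(0)\<close> and
  midpoint convex, so this is at most \<open>\<psi>(0) t / s\<close>.\<close>

section \<open>Signed powers\<close>

text \<open>Keeping the sign makes this an odd bijection of the reals for \<open>r > 0\<close>, with
  inverse exponent \<open>1 / r\<close>. A plain power of the absolute value would reach only
  non-negative functions.\<close>

definition signed_powr :: "real \<Rightarrow> real \<Rightarrow> real" where
  "signed_powr r a = sgn a * \<bar>a\<bar> powr r"

lemma abs_signed_powr: "\<bar>signed_powr r a\<bar> = \<bar>a\<bar> powr r"
  by (auto simp: signed_powr_def abs_mult abs_sgn_eq)

lemma signed_powr_inverse: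
  assumes "r > 0"
  shows "signed_powr r (signed_powr (1 / r) a) = a"
  using assms
  by (auto simp: signed_powr_def abs_mult sgn_mult powr_powr abs_sgn_eq sgn_if)

lemma signed_powr_measurable [measurable]: "signed_powr r \<in> borel_measurable borel"
  unfolding signed_powr_def by measurable

text \<open>Mean value theorem: the derivative \<open>r * z powr (r - 1)\<close> is nondecreasing
  because \<open>r\<close> is at least 1, so its value at \<open>a\<close> dominates. The case
  \<open>b = 0\<close> is separate because the derivative is taken at positive points only.\<close>

lemma powr_diff_le:
  fixes a b r :: real
  assumes "1 \<le> r" "0 \<le> b" "b \<le> a"
  shows "a powr r - b powr r \<le> r * a powr (r - 1) * (a - b)"
proof -
  consider "b = 0" | "b = a" | "0 < b" "b < a" using assms by linarith
  then show ?thesis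
  proof cases
    case 1
    have "a powr r = a powr (r - 1) * a"
      using assms by (cases "a = 0") (auto simp: powr_mult_base[symmetric] powr_diff)
    also have "\<dots> \<le> r * (a powr (r - 1) * a)"
      using assms mult_right_mono[of 1 r "a powr (r - 1) * a"] by simp
    finally show ?thesis using 1 by (simp add: algebra_simps)
  next
    case 2
    then show ?thesis by simp
  next
    case 3
    have "\<exists>z>b. z < a \<and> a powr r - b powr r = (a - b) * (r * z powr (r - 1))"
      using 3 by (intro MVT2) (auto intro!: has_real_derivative_powr)
    then obtain z where z: "b < z" "z < a"
      and eq: "a powr r - b powr r = (a - b) * (r * z powr (r - 1))" by blast
    have "z powr (r - 1) \<le> a powr (r - 1)"
      using z 3 assms by (intro powr_mono2) auto
    then have "(a - b) * (r * z powr (r - 1)) \<le> (a - b) * (r * a powr (r - 1))"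
      using 3 assms by (intro mult_left_mono) auto
    then show ?thesis using eq by (simp add: algebra_simps)
  qed
qed

text \<open>For equal signs this is the one-sided estimate for the absolute values. For opposite
  signs both sides turn into sums: the difference is |a|^r + |b|^r, the distance is |a| + |b|, and
  each |.|^(r-1) is at most (|a| + |b|)^(r-1).\<close>

lemma abs_signed_powr_diff_le:
  assumes "1 \<le> r"
  shows "\<bar>signed_powr r a - signed_powr r b\<bar> \<le> r * (\<bar>a\<bar> + \<bar>b\<bar>) powr (r - 1) * \<bar>a - b\<bar>"
proof -
  have same: "\<bar>x powr r - y powr r\<bar> \<le> r * (x + y) powr (r - 1) * \<bar>x - y\<bar>"
    if "0 \<le> x" "0 \<le> y" for x y :: real
    using that
  proof (induction x y rule: linorder_wlog)
    case (le x y)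
    have "y powr r - x powr r \<le> r * y powr (r - 1) * (y - x)"
      using powr_diff_le[of r x y] assms le by simp
    also have "\<dots> \<le> r * (x + y) powr (r - 1) * (y - x)"
      using assms le by (intro mult_right_mono mult_left_mono powr_mono2) auto
    finally show ?case
      using le assms powr_mono2[of r x y] by simp
  next
    case (sym x y)
    then show ?case by (simp add: abs_minus_commute add.commute)
  qed
  have opposite: "x powr r + y powr r \<le> r * (x + y) powr (r - 1) * (x + y)"
    if "0 \<le> x" "0 \<le> y" for x y :: real
  proof -
    have split: "z powr r = z powr (r - 1) * z" if "0 \<le> z" for z :: real
      using that by (cases "z = 0") (auto simp: powr_diff)
    have "x powr r + y powr r \<le> (x + y) powr (r - 1) * x + (x + y) powr (r - 1) * y"
      unfolding split[OF that(1)] split[OF that(2)]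
      using that assms by (intro add_mono mult_right_mono powr_mono2) auto
    also have "\<dots> = 1 * ((x + y) powr (r - 1) * (x + y))"
      by (simp add: algebra_simps)
    also have "\<dots> \<le> r * ((x + y) powr (r - 1) * (x + y))"
      using assms that by (intro mult_right_mono) auto
    finally show ?thesis by (simp add: mult.assoc)
  qed
  consider "0 \<le> a" "0 \<le> b" | "a < 0" "b < 0" | "0 \<le> a" "b < 0" | "a < 0" "0 \<le> b" by linarith
  then show ?thesis
  proof cases
    case 1
    then show ?thesis using same[of a b] by (auto simp: signed_powr_def sgn_if)
  next
    case 2
    then show ?thesis using same[of "-a" "-b"] by (auto simp: signed_powr_def sgn_if abs_minus_commute)
  next
    case 3
    then show ?thesis using opposite[of a "-b"] by (auto simp: signed_powr_def sgn_if)
  next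
    case 4
    then show ?thesis using opposite[of b "-a"]
      by (subst (1 2) abs_minus_commute) (auto simp: signed_powr_def sgn_if)
  qed
qed

section \<open>Power inequalities with a free scale\<close>

lemma powr_add_le:
  fixes x y p :: real
  assumes "0 \<le> x" "0 \<le> y" "0 \<le> p"
  shows "(x + y) powr p \<le> 2 powr p * (x powr p + y powr p)"
proof -
  have "(x + y) powr p \<le> (2 * max x y) powr p"
    using assms by (intro powr_mono2) auto
  also have "\<dots> = 2 powr p * max x y powr p"
    using assms by (simp add: powr_mult)
  also have "\<dots> \<le> 2 powr p * (x powr p + y powr p)"
    using assms by (auto simp: max_def)
  finally show ?thesis .
qed

lemma abs_diff_powr_le:
  fixes a b p :: real
  assumes "0 \<le> p"
  shows "\<bar>a - b\<bar> powr p \<le> 2 powr p * (\<bar>a\<bar> powr p + \<bar>b\<bar> powr p)"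
proof -
  have "\<bar>a - b\<bar> powr p \<le> (\<bar>a\<bar> + \<bar>b\<bar>) powr p"
    using assms by (intro powr_mono2) auto
  also have "\<dots> \<le> 2 powr p * (\<bar>a\<bar> powr p + \<bar>b\<bar> powr p)"
    using assms by (intro powr_add_le) auto
  finally show ?thesis .
qed

text \<open>Weighted Young inequality for \<open>l powr \<theta> * A\<close> and
  \<open>l powr (\<theta> - 1) * B\<close>. The powers of \<open>l\<close> are chosen so that they
  cancel in the weighted geometric mean, which leaves \<open>l\<close> free on the right
  only.\<close>

lemma powr_mult_powr_le_scaled:
  fixes A B \<theta> l :: real
  assumes "0 < \<theta>" "\<theta> \<le> 1" "0 < l" "0 \<le> A" "0 \<le> B"
  shows "A powr (1 - \<theta>) * B powr \<theta> \<le> l powr \<theta> * A + l powr (\<theta> - 1) * B"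
\<comment> \<open>Since \<open>0 powr 0\<close> is 0, the left side vanishes here even for
  \<open>\<theta> = 1\<close>, which is the case \<open>p = q\<close> later on.\<close>
proof (cases "A = 0 \<or> B = 0")
  case True
  then show ?thesis using assms by auto
next
  case False
  with assms have "A > 0" "B > 0" by auto
  have "(l powr \<theta> * A) powr (1 - \<theta>) * (l powr (\<theta> - 1) * B) powr \<theta>
      \<le> (1 - \<theta>) * (l powr \<theta> * A) + \<theta> * (l powr (\<theta> - 1) * B)"
    using assms \<open>A > 0\<close> \<open>B > 0\<close> by (intro Youngs_inequality_0) auto
  also have "\<dots> \<le> 1 * (l powr \<theta> * A) + 1 * (l powr (\<theta> - 1) * B)"
    using assms by (intro add_mono mult_right_mono) auto
  also have "(l powr \<theta> * A) powr (1 - \<theta>) * (l powr (\<theta> - 1) * B) powr \<theta>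
      = (l powr (\<theta> * (1 - \<theta>)) * l powr ((\<theta> - 1) * \<theta>)) * (A powr (1 - \<theta>) * B powr \<theta>)"
    using assms by (simp add: powr_mult powr_powr)
  also have "l powr (\<theta> * (1 - \<theta>)) * l powr ((\<theta> - 1) * \<theta>) = 1"
    using assms by (simp add: powr_add[symmetric] algebra_simps)
  finally show ?thesis by simp
qed

text \<open>The q-th power of the Lipschitz-type bound is a product A^(1 - q/p) B^(q/p), with A
  comparable to |a|^p + |b|^p and B = |a - b|^p. Splitting it with scale \<open>l\<close> puts a
  small weight on the merely bounded term A, at the price of a large weight on the small term
  B.\<close>

lemma signed_powr_diff_powr_le:
  fixes p q l a b :: real
  assumes "1 \<le> q" "q \<le> p" "0 < l"
  shows "\<bar>signed_powr (p / q) a - signed_powr (p / q) b\<bar> powr q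
    \<le> (p / q) powr q * 2 powr p *
       (l powr (q / p) * (\<bar>a\<bar> powr p + \<bar>b\<bar> powr p) + l powr (q / p - 1) * \<bar>a - b\<bar> powr p)"
proof -
  define A B where "A = (\<bar>a\<bar> + \<bar>b\<bar>) powr p" and "B = \<bar>a - b\<bar> powr p"
  have "\<bar>signed_powr (p / q) a - signed_powr (p / q) b\<bar> powr q
      \<le> (p / q * (\<bar>a\<bar> + \<bar>b\<bar>) powr (p / q - 1) * \<bar>a - b\<bar>) powr q"
    using assms by (intro powr_mono2 abs_signed_powr_diff_le) auto
  also have "\<dots> = (p / q) powr q * (A powr (1 - q / p) * B powr (q / p))"
  proof -
    have "(p / q - 1) * q = p * (1 - q / p)" "p * (q / p) = q"
      using assms by (auto simp: field_simps)
    with assms show ?thesis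
      by (simp add: A_def B_def powr_mult powr_powr powr_divide)
  qed
  also have "\<dots> \<le> (p / q) powr q * (l powr (q / p) * A + l powr (q / p - 1) * B)"
    using assms by (intro mult_left_mono powr_mult_powr_le_scaled) (auto simp: A_def B_def)
  \<comment> \<open>As \<open>2 powr p\<close> is at least 1, the term with \<open>B\<close> may
    carry it as well, and it becomes a common factor.\<close>
  also have "\<dots> \<le> (p / q) powr q * (l powr (q / p) * (2 powr p * (\<bar>a\<bar> powr p + \<bar>b\<bar> powr p))
      + 2 powr p * (l powr (q / p - 1) * B))"
    using assms powr_mono[of 0 p 2]
    by (intro mult_left_mono add_mono)
       (auto simp: A_def B_def intro!: powr_add_le mult_le_cancel_right1[THEN iffD2])
  finally show ?thesis by (simp add: B_def algebra_simps)
qed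

section \<open>Lebesgue and Besov spaces\<close>

lemma LpD:
  assumes "f \<in> Lp M p"
  shows "f \<in> borel_measurable M" "integrable M (\<lambda>x. \<bar>f x\<bar> powr p)"
  using assms by (auto simp: Lp_def)

lemma Lp_diff_integrable:
  assumes "0 \<le> p" "f \<in> Lp M p" "g \<in> Lp M p"
  shows "integrable M (\<lambda>x. \<bar>f x - g x\<bar> powr p)"
proof (rule Bochner_Integration.integrable_bound)
  note [measurable] = LpD(1)[OF assms(2)] LpD(1)[OF assms(3)]
  show "integrable M (\<lambda>x. 2 powr p * (\<bar>f x\<bar> powr p + \<bar>g x\<bar> powr p))"
    using assms LpD(2) by (intro integrable_mult_right Bochner_Integration.integrable_add) auto
  show "(\<lambda>x. \<bar>f x - g x\<bar> powr p) \<in> borel_measurable M" by measurable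
  show "AE x in M. norm (\<bar>f x - g x\<bar> powr p) \<le> norm (2 powr p * (\<bar>f x\<bar> powr p + \<bar>g x\<bar> powr p))"
    using abs_diff_powr_le[OF assms(1)] by auto
qed

lemma Lp_norm_less_iff:
  assumes "0 < p" "0 < \<epsilon>"
  shows "Lp_norm M p f < \<epsilon> \<longleftrightarrow> (\<integral>x. \<bar>f x\<bar> powr p \<partial>M) < \<epsilon> powr p"
proof -
  have "(\<integral>x. \<bar>f x\<bar> powr p \<partial>M) powr (1 / p) < \<epsilon> \<longleftrightarrow>
      ((\<integral>x. \<bar>f x\<bar> powr p \<partial>M) powr (1 / p)) powr p < \<epsilon> powr p"
    using assms powr_less_mono2[of p] powr_mono2[of p \<epsilon>]
    by (smt (verit) powr_ge_zero)
  then show ?thesis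
    using assms by (simp add: Lp_norm_def powr_powr)
qed

text \<open>Replacing \<epsilon> by a suitable power removes the root, so that density can be tested
  on integrals alone.\<close>

lemma dense_in_Lp_iff:
  assumes "0 < p"
  shows "dense_in_Lp M p S \<longleftrightarrow> S \<subseteq> Lp M p \<and>
    (\<forall>f\<in>Lp M p. \<forall>\<epsilon>>0. \<exists>g\<in>S. (\<integral>x. \<bar>f x - g x\<bar> powr p \<partial>M) < \<epsilon>)"
proof -
  have "(\<forall>\<epsilon>>0. \<exists>g\<in>S. Lp_norm M p (\<lambda>x. f x - g x) < \<epsilon>) \<longleftrightarrow>
      (\<forall>\<epsilon>>0. \<exists>g\<in>S. (\<integral>x. \<bar>f x - g x\<bar> powr p \<partial>M) < \<epsilon>)" (is "?L \<longleftrightarrow> ?R") for f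
  proof
    assume ?L
    show ?R
    proof (intro allI impI)
      fix \<epsilon> :: real assume "0 < \<epsilon>"
      then have "0 < \<epsilon> powr (1 / p)" by simp
      with \<open>?L\<close> obtain g where "g \<in> S" "Lp_norm M p (\<lambda>x. f x - g x) < \<epsilon> powr (1 / p)" by blast
      then show "\<exists>g\<in>S. (\<integral>x. \<bar>f x - g x\<bar> powr p \<partial>M) < \<epsilon>"
        using \<open>0 < \<epsilon>\<close> assms by (auto simp: Lp_norm_less_iff powr_powr)
    qed
  next
    assume ?R
    then show ?L using assms by (simp add: Lp_norm_less_iff)
  qed
  then show ?thesis unfolding dense_in_Lp_def by blast
qed

text \<open>The double integral in the Besov seminorm at one fixed time, before the root is taken;
  \<open>k\<close> stands for \<open>\<kappa> t\<close>. Values in \<open>ennreal\<close> allow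
  estimates before finiteness is known.\<close>

definition heat_energy :: "'a measure \<Rightarrow> ('a \<Rightarrow> 'a measure) \<Rightarrow> real \<Rightarrow> ('a \<Rightarrow> real) \<Rightarrow> ennreal" where
  "heat_energy M k p f = (\<integral>\<^sup>+y. (\<integral>\<^sup>+x. ennreal (\<bar>f x - f y\<bar> powr p) \<partial>k y) \<partial>M)"

lemma ennreal_powr_mono:
  assumes "0 \<le> a" "x \<le> ennreal y" "0 \<le> y"
  shows "ennreal_powr x a \<le> ennreal (y powr a)"
proof -
  have "x \<noteq> \<infinity>" using assms by (auto simp: top_unique)
  then show ?thesis
    using assms by (auto simp: ennreal_powr_def intro!: ennreal_leI powr_mono2 enn2real_leI)
qed

text \<open>Taking p-th powers in the supremum turns finiteness of the seminorm into a bound of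
  order t^(\<alpha> p) on the energy, uniform in t; the constant is the p-th power of the
  seminorm.\<close>

lemma besov_space_iff:
  assumes "1 \<le> p"
  shows "f \<in> besov_space M \<kappa> p \<alpha> \<longleftrightarrow> f \<in> Lp M p \<and>
    (\<exists>K\<ge>0. \<forall>t>0. heat_energy M (\<kappa> t) p f \<le> ennreal (K * t powr (\<alpha> * p)))"
proof -
  have "(\<exists>K\<ge>0. \<forall>t>0. heat_energy M (\<kappa> t) p f \<le> ennreal (K * t powr (\<alpha> * p)))"
    if fin: "besov_seminorm M \<kappa> p \<alpha> f < \<infinity>"
  proof -
    define S where "S = enn2real (besov_seminorm M \<kappa> p \<alpha> f)"
    have S: "besov_seminorm M \<kappa> p \<alpha> f = ennreal S" "0 \<le> S"
      using fin by (auto simp: S_def)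
    have "heat_energy M (\<kappa> t) p f \<le> ennreal (S powr p * t powr (\<alpha> * p))" if "0 < t" for t
    proof -
      let ?E = "heat_energy M (\<kappa> t) p f"
      have le: "ennreal (t powr (- \<alpha>)) * ennreal_powr ?E (1 / p) \<le> ennreal S"
        unfolding S(1)[symmetric] besov_seminorm_def heat_energy_def
        using that by (intro SUP_upper) auto
      have "?E \<noteq> \<infinity>"
      proof
        assume "?E = \<infinity>"
        with le that show False
          by (simp add: ennreal_powr_def ennreal_mult_top top_unique)
      qed
      then obtain w where w: "?E = ennreal w" "0 \<le> w" by (cases ?E) auto
      have "t powr (- \<alpha>) * w powr (1 / p) \<le> S"
        using le w S by (simp add: ennreal_powr_def ennreal_mult[symmetric])
      then have "w powr (1 / p) \<le> S * t powr \<alpha>"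
        using that by (simp add: powr_minus field_simps)
      then have "(w powr (1 / p)) powr p \<le> (S * t powr \<alpha>) powr p"
        using assms by (intro powr_mono2) auto
      then have "w \<le> S powr p * t powr (\<alpha> * p)"
        using w assms S by (simp add: powr_powr powr_mult)
      then show ?thesis using w by (auto intro: ennreal_leI)
    qed
    then show ?thesis by (intro exI[of _ "S powr p"]) auto
  qed
  moreover have "besov_seminorm M \<kappa> p \<alpha> f < \<infinity>"
    if "0 \<le> K" and K: "\<And>t. 0 < t \<Longrightarrow> heat_energy M (\<kappa> t) p f \<le> ennreal (K * t powr (\<alpha> * p))" for K
  proof -
    have "besov_seminorm M \<kappa> p \<alpha> f \<le> ennreal (K powr (1 / p))"
      unfolding besov_seminorm_def heat_energy_def[symmetric]
    proof (rule SUP_least)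
      fix t :: real assume "t \<in> {0<..}"
      then have t: "0 < t" by simp
      have "ennreal (t powr (- \<alpha>)) * ennreal_powr (heat_energy M (\<kappa> t) p f) (1 / p)
          \<le> ennreal (t powr (- \<alpha>)) * ennreal ((K * t powr (\<alpha> * p)) powr (1 / p))"
        using assms K[OF t] \<open>0 \<le> K\<close> by (intro mult_left_mono ennreal_powr_mono) auto
      also have "\<dots> = ennreal (t powr (- \<alpha>) * (K * t powr (\<alpha> * p)) powr (1 / p))"
        by (simp add: ennreal_mult)
      also have "t powr (- \<alpha>) * (K * t powr (\<alpha> * p)) powr (1 / p) = K powr (1 / p)"
        using assms t \<open>0 \<le> K\<close> by (simp add: powr_mult powr_powr powr_minus)
      finally show "ennreal (t powr (- \<alpha>)) * ennreal_powr (heat_energy M (\<kappa> t) p f) (1 / p)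
          \<le> ennreal (K powr (1 / p))" .
    qed
    then show ?thesis using le_less_trans by fastforce
  qed
  ultimately show ?thesis unfolding besov_space_def by blast
qed

section \<open>Signed powers acting on Lebesgue and Besov spaces\<close>

lemma signed_powr_Lp:
  assumes "0 < q" "0 < p" "f \<in> Lp M p"
  shows "(\<lambda>x. signed_powr (p / q) (f x)) \<in> Lp M q"
  using assms by (auto simp: Lp_def abs_signed_powr powr_powr)

lemma kernel_sets:
  assumes "k \<in> measurable M (prob_algebra M)" "y \<in> space M"
  shows "sets (k y) = sets M" "space (k y) = space M" "prob_space (k y)"
proof -
  have "k y \<in> space (prob_algebra M)"
    using assms by (rule measurable_space)
  then show "sets (k y) = sets M" "prob_space (k y)"
    by (auto simp: space_prob_algebra)
  then show "space (k y) = space M" by (auto dest: sets_eq_imp_space_eq)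
qed

text \<open>The pointwise estimate is integrated first against \<open>k y\<close> and then over
  \<open>M\<close>. The term |f(y)|^p is constant for the inner integral and comes out unchanged
  because \<open>k y\<close> has mass one.\<close>

lemma heat_energy_signed_powr_le:
  assumes pq: "1 \<le> q" "q \<le> p" and l: "0 < l"
    and k: "k \<in> measurable M (prob_algebra M)"
    and f: "f \<in> borel_measurable M"
  defines "C \<equiv> (p / q) powr q * 2 powr p"
  shows "heat_energy M k q (\<lambda>x. signed_powr (p / q) (f x)) \<le>
    ennreal (C * l powr (q / p)) * ((\<integral>\<^sup>+y. (\<integral>\<^sup>+x. ennreal (\<bar>f x\<bar> powr p) \<partial>k y) \<partial>M) +
        (\<integral>\<^sup>+y. ennreal (\<bar>f y\<bar> powr p) \<partial>M)) +
    ennreal (C * l powr (q / p - 1)) * heat_energy M k p f"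
proof -
  define c d where "c = C * l powr (q / p)" and "d = C * l powr (q / p - 1)"
  have cd: "0 \<le> c" "0 \<le> d" by (auto simp: c_def d_def C_def)
  have inner: "(\<integral>\<^sup>+x. ennreal (\<bar>signed_powr (p / q) (f x) - signed_powr (p / q) (f y)\<bar> powr q) \<partial>k y)
      \<le> ennreal c * ((\<integral>\<^sup>+x. ennreal (\<bar>f x\<bar> powr p) \<partial>k y) + ennreal (\<bar>f y\<bar> powr p)) +
         ennreal d * (\<integral>\<^sup>+x. ennreal (\<bar>f x - f y\<bar> powr p) \<partial>k y)" if y: "y \<in> space M" for y
  proof -
    have [measurable]: "f \<in> borel_measurable (k y)"
      using f kernel_sets(1)[OF k y] by (simp cong: measurable_cong_sets)
    interpret prob_space "k y" by (rule kernel_sets(3)[OF k y])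
    have "(\<integral>\<^sup>+x. ennreal (\<bar>signed_powr (p / q) (f x) - signed_powr (p / q) (f y)\<bar> powr q) \<partial>k y)
        \<le> (\<integral>\<^sup>+x. ennreal c * (ennreal (\<bar>f x\<bar> powr p) + ennreal (\<bar>f y\<bar> powr p)) +
            ennreal d * ennreal (\<bar>f x - f y\<bar> powr p) \<partial>k y)"
    proof (rule nn_integral_mono)
      fix x
      show "ennreal (\<bar>signed_powr (p / q) (f x) - signed_powr (p / q) (f y)\<bar> powr q) \<le>
          ennreal c * (ennreal (\<bar>f x\<bar> powr p) + ennreal (\<bar>f y\<bar> powr p)) +
            ennreal d * ennreal (\<bar>f x - f y\<bar> powr p)"
        using signed_powr_diff_powr_le[OF pq l, of "f x" "f y"] cd
        by (simp add: ennreal_plus[symmetric] ennreal_mult[symmetric] c_def d_def C_def algebra_simps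
            del: ennreal_plus)
    qed
    also have "\<dots> = ennreal c * ((\<integral>\<^sup>+x. ennreal (\<bar>f x\<bar> powr p) \<partial>k y) + ennreal (\<bar>f y\<bar> powr p)) +
         ennreal d * (\<integral>\<^sup>+x. ennreal (\<bar>f x - f y\<bar> powr p) \<partial>k y)"
      by (simp add: nn_integral_add nn_integral_cmult emeasure_space_1)
    finally show ?thesis .
  qed
  \<comment> \<open>Splitting the outer integral needs measurability of the inner integrals in
    \<open>y\<close>, which follows from measurability of the kernel as a map into the space of
    subprobability measures.\<close>
  note [measurable] = f measurable_prob_algebraD[OF k]
  note [measurable (raw)] = nn_integral_measurable_subprob_algebra2
  have "heat_energy M k q (\<lambda>x. signed_powr (p / q) (f x)) \<le>
      (\<integral>\<^sup>+y. ennreal c * ((\<integral>\<^sup>+x. ennreal (\<bar>f x\<bar> powr p) \<partial>k y) + ennreal (\<bar>f y\<bar> powr p)) +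
         ennreal d * (\<integral>\<^sup>+x. ennreal (\<bar>f x - f y\<bar> powr p) \<partial>k y) \<partial>M)"
    unfolding heat_energy_def by (intro nn_integral_mono inner)
  also have "\<dots> = ennreal c * ((\<integral>\<^sup>+y. (\<integral>\<^sup>+x. ennreal (\<bar>f x\<bar> powr p) \<partial>k y) \<partial>M) +
        (\<integral>\<^sup>+y. ennreal (\<bar>f y\<bar> powr p) \<partial>M)) + ennreal d * heat_energy M k p f"
    unfolding heat_energy_def
    by (subst nn_integral_add nn_integral_cmult; measurable)+
  finally show ?thesis by (simp add: c_def d_def)
qed

lemma heat_kernel_nn_integral:
  assumes "heat_kernel M P \<kappa>" "0 \<le> t" "1 \<le> p" "f \<in> Lp M p" "\<And>x. x \<in> space M \<Longrightarrow> 0 \<le> f x"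
  shows "AE y in M. ennreal (P t f y) = (\<integral>\<^sup>+x. ennreal (f x) \<partial>\<kappa> t y)"
  using assms unfolding heat_kernel_def by meson

text \<open>The inner integral represents \<open>P t f\<close>, so this is the contraction property
  on L^1. Passing to the absolute value of \<open>P t f\<close> turns the outer integral into that
  norm.\<close>

lemma heat_kernel_nn_integral_le:
  assumes "heat_semigroup M \<E> \<F> P" "heat_kernel M P \<kappa>" "0 \<le> t" "f \<in> Lp M 1"
    and nonneg: "\<forall>x\<in>space M. 0 \<le> f x"
  shows "(\<integral>\<^sup>+y. (\<integral>\<^sup>+x. ennreal (f x) \<partial>\<kappa> t y) \<partial>M) \<le> ennreal (\<integral>x. f x \<partial>M)"
proof -
  have cont: "contraction_semigroup_Lp M 1 P"
    using assms(1) unfolding heat_semigroup_def by auto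
  then have P: "P t f \<in> Lp M 1" "Lp_norm M 1 (P t f) \<le> Lp_norm M 1 f"
    using assms(3,4) unfolding contraction_semigroup_Lp_def linear_semigroup_on_def by auto
  have "AE y in M. ennreal (P t f y) = (\<integral>\<^sup>+x. ennreal (f x) \<partial>\<kappa> t y)"
    using assms by (intro heat_kernel_nn_integral[where p = 1]) auto
  then have "(\<integral>\<^sup>+y. (\<integral>\<^sup>+x. ennreal (f x) \<partial>\<kappa> t y) \<partial>M) = (\<integral>\<^sup>+y. ennreal (P t f y) \<partial>M)"
    by (intro nn_integral_cong_AE) auto
  also have "\<dots> \<le> (\<integral>\<^sup>+y. ennreal \<bar>P t f y\<bar> \<partial>M)"
    by (intro nn_integral_mono) (simp add: ennreal_leI)
  also have "\<dots> = ennreal (\<integral>y. \<bar>P t f y\<bar> \<partial>M)"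
    using LpD(2)[OF P(1)] by (intro nn_integral_eq_integral) auto
  also have "(\<integral>y. \<bar>P t f y\<bar> \<partial>M) \<le> (\<integral>y. \<bar>f y\<bar> \<partial>M)"
    using P(2) by (simp add: Lp_norm_def)
  also have "(\<integral>y. \<bar>f y\<bar> \<partial>M) = (\<integral>y. f y \<partial>M)"
    using nonneg by (intro Bochner_Integration.integral_cong) auto
  finally show ?thesis by (simp add: ennreal_leI)
qed

lemma signed_powr_besov_space:
  assumes heat: "heat_semigroup M \<E> \<F> P" "heat_kernel M P \<kappa>"
    and pq: "1 \<le> q" "q \<le> p" and f: "f \<in> besov_space M \<kappa> p \<alpha>"
  shows "(\<lambda>x. signed_powr (p / q) (f x)) \<in> besov_space M \<kappa> q \<alpha>"
proof -
  define C where "C = (p / q) powr q * 2 powr p"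
  define A where "A = (\<integral>x. \<bar>f x\<bar> powr p \<partial>M)"
  from f pq obtain K where Lp: "f \<in> Lp M p" and K: "0 \<le> K"
    and E: "\<And>t. 0 < t \<Longrightarrow> heat_energy M (\<kappa> t) p f \<le> ennreal (K * t powr (\<alpha> * p))"
    by (auto simp: besov_space_iff)
  have nonneg: "0 \<le> C" "0 \<le> A" by (auto simp: C_def A_def)
  have L1: "(\<lambda>x. \<bar>f x\<bar> powr p) \<in> Lp M 1"
    using LpD[OF Lp] by (auto simp: Lp_def)
  have nn: "(\<integral>\<^sup>+y. ennreal (\<bar>f y\<bar> powr p) \<partial>M) = ennreal A"
    unfolding A_def using LpD(2)[OF Lp] by (intro nn_integral_eq_integral) auto
  have "heat_energy M (\<kappa> t) q (\<lambda>x. signed_powr (p / q) (f x))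
      \<le> ennreal ((2 * C * A + C * K) * t powr (\<alpha> * q))" if t: "0 < t" for t
  proof -
    \<comment> \<open>With this scale the energy bound K t^(\<alpha> p) is \<open>K * l\<close>, so
      both terms have the same order l^(q/p) = t^(\<alpha> q), the order required for exponent
      q.\<close>
    define l where "l = t powr (\<alpha> * p)"
    have l: "0 < l" using t by (simp add: l_def)
    have k: "\<kappa> t \<in> measurable M (prob_algebra M)"
      using heat(2) t unfolding heat_kernel_def by auto
    have "heat_energy M (\<kappa> t) q (\<lambda>x. signed_powr (p / q) (f x)) \<le>
        ennreal (C * l powr (q / p)) * ((\<integral>\<^sup>+y. (\<integral>\<^sup>+x. ennreal (\<bar>f x\<bar> powr p) \<partial>\<kappa> t y) \<partial>M) +
        (\<integral>\<^sup>+y. ennreal (\<bar>f y\<bar> powr p) \<partial>M)) +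
        ennreal (C * l powr (q / p - 1)) * heat_energy M (\<kappa> t) p f"
      unfolding C_def using LpD(1)[OF Lp] by (rule heat_energy_signed_powr_le[OF pq l k])
    \<comment> \<open>One \<open>A\<close> comes from the contraction bound for the kernel integral,
      the other is the integral of |f|^p itself.\<close>
    also have "\<dots> \<le> ennreal (C * l powr (q / p)) * (ennreal A + ennreal A) +
        ennreal (C * l powr (q / p - 1)) * ennreal (K * l)"
      unfolding nn
      using heat_kernel_nn_integral_le[OF heat _ L1, of t] E[OF t] t
      by (intro add_mono mult_left_mono) (auto simp: l_def A_def)
    also have "\<dots> = ennreal (C * l powr (q / p) * (A + A) + C * l powr (q / p - 1) * (K * l))"
      using nonneg K l
      by (simp add: ennreal_mult[symmetric] ennreal_plus[symmetric] del: ennreal_plus)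
    also have "l powr (q / p - 1) * l = l powr (q / p)"
      using l by (simp add: powr_diff)
    then have "C * l powr (q / p) * (A + A) + C * l powr (q / p - 1) * (K * l)
        = (2 * C * A + C * K) * l powr (q / p)"
      by (simp add: algebra_simps)
    also have "l powr (q / p) = t powr (\<alpha> * q)"
      using pq by (simp add: l_def powr_powr)
    finally show ?thesis .
  qed
  moreover have "0 \<le> 2 * C * A + C * K" using nonneg K by auto
  ultimately show ?thesis
    using pq signed_powr_Lp[OF _ _ Lp, of q] by (auto simp: besov_space_iff)
qed

text \<open>Pull \<open>f\<close> back to \<open>h\<close> in L^p, approximate \<open>h\<close> by
  \<open>g\<close> in \<open>S\<close>, and push \<open>g\<close> forward. The order of choices
  matters: \<open>l\<close> makes the bounded term at most \<epsilon>/2, and only then is the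
  accuracy \<delta> of \<open>g\<close> fixed, depending on \<open>l\<close>.\<close>

lemma signed_powr_dense:
  assumes pq: "1 \<le> q" "q \<le> p"
    and dense: "dense_in_Lp M p S" and T: "T \<subseteq> Lp M q"
    and ST: "\<And>f. f \<in> S \<Longrightarrow> (\<lambda>x. signed_powr (p / q) (f x)) \<in> T"
  shows "dense_in_Lp M q T"
proof -
  define C where "C = (p / q) powr q * 2 powr p"
  have C: "0 < C" using pq by (simp add: C_def)
  have "\<exists>g\<in>T. (\<integral>x. \<bar>f x - g x\<bar> powr q \<partial>M) < \<epsilon>" if f: "f \<in> Lp M q" and \<epsilon>: "0 < \<epsilon>" for f \<epsilon>
  proof -
    define h where "h = (\<lambda>x. signed_powr (q / p) (f x))"
    have h: "h \<in> Lp M p" unfolding h_def using pq f by (intro signed_powr_Lp) auto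
    have inv: "signed_powr (p / q) (h x) = f x" for x
      using signed_powr_inverse[of "p / q" "f x"] pq by (simp add: h_def)
    define H where "H = (\<integral>x. \<bar>h x\<bar> powr p \<partial>M)"
    \<comment> \<open>A bound for the p-th powers of \<open>h\<close> and \<open>g\<close> together,
      valid for every \<open>g\<close> within distance 1 of \<open>h\<close>; this is why \<delta>
      is capped at 1. It has to be known before \<open>g\<close> is chosen.\<close>
    define A where "A = H + 2 powr p * (H + 1)"
    have "0 \<le> H" by (simp add: H_def)
    then have A: "0 < A" by (auto simp: A_def intro!: add_nonneg_pos mult_pos_pos)
    define l where "l = (\<epsilon> / (2 * C * A)) powr (p / q)"
    have l: "0 < l" using \<epsilon> C A by (simp add: l_def)
    have "l powr (q / p) = \<epsilon> / (2 * C * A)"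
      using pq \<epsilon> C A by (simp add: l_def powr_powr)
    then have lA: "C * (l powr (q / p) * A) = \<epsilon> / 2"
      using C A by (simp add: field_simps)
    define \<delta> where "\<delta> = min 1 (\<epsilon> / (2 * C * l powr (q / p - 1)))"
    have "0 < \<delta>" using \<epsilon> C l by (simp add: \<delta>_def)
    then have "\<exists>g\<in>S. (\<integral>x. \<bar>h x - g x\<bar> powr p \<partial>M) < \<delta>"
      using dense h pq by (simp add: dense_in_Lp_iff)
    then obtain g where g: "g \<in> S" and gd: "(\<integral>x. \<bar>h x - g x\<bar> powr p \<partial>M) < \<delta>"
      by blast
    have gL: "g \<in> Lp M p" using g dense by (auto simp: dense_in_Lp_def)
    define B where "B = (\<integral>x. \<bar>h x - g x\<bar> powr p \<partial>M)"
    note int = LpD(2)[OF h] LpD(2)[OF gL] Lp_diff_integrable[OF _ h gL]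
    have p0: "0 \<le> p" using pq by simp
    have "(\<integral>x. \<bar>g x\<bar> powr p \<partial>M) \<le> (\<integral>x. 2 powr p * (\<bar>h x\<bar> powr p + \<bar>h x - g x\<bar> powr p) \<partial>M)"
      using int p0 abs_diff_powr_le[of p "h x" "h x - g x" for x] by (intro integral_mono) auto
    also have "\<dots> = 2 powr p * (H + B)"
      using int p0 by (simp add: H_def B_def)
    also have "\<dots> \<le> 2 powr p * (H + 1)"
      using gd by (simp add: B_def \<delta>_def)
    finally have G: "H + (\<integral>x. \<bar>g x\<bar> powr p \<partial>M) \<le> A" by (simp add: A_def)
    have "(\<integral>x. \<bar>f x - signed_powr (p / q) (g x)\<bar> powr q \<partial>M) \<le>
        (\<integral>x. C * (l powr (q / p) * (\<bar>h x\<bar> powr p + \<bar>g x\<bar> powr p) +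
            l powr (q / p - 1) * \<bar>h x - g x\<bar> powr p) \<partial>M)"
    \<comment> \<open>A non-integrable left side would have integral 0, so an integrable
      non-negative majorant is enough.\<close>
    proof (rule integral_mono')
      show "\<bar>f x - signed_powr (p / q) (g x)\<bar> powr q \<le>
          C * (l powr (q / p) * (\<bar>h x\<bar> powr p + \<bar>g x\<bar> powr p) +
            l powr (q / p - 1) * \<bar>h x - g x\<bar> powr p)" for x
        using signed_powr_diff_powr_le[OF pq l, of "h x" "g x"] unfolding inv C_def .
      show "integrable M (\<lambda>x. C * (l powr (q / p) * (\<bar>h x\<bar> powr p + \<bar>g x\<bar> powr p) +
            l powr (q / p - 1) * \<bar>h x - g x\<bar> powr p))"
        using int p0 by (intro integrable_mult_right Bochner_Integration.integrable_add) auto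
    next
      fix x
      show "0 \<le> C * (l powr (q / p) * (\<bar>h x\<bar> powr p + \<bar>g x\<bar> powr p) +
            l powr (q / p - 1) * \<bar>h x - g x\<bar> powr p)"
        using C by (intro mult_nonneg_nonneg add_nonneg_nonneg) auto
    qed
    also have "\<dots> = C * (l powr (q / p) * (H + (\<integral>x. \<bar>g x\<bar> powr p \<partial>M))) + C * l powr (q / p - 1) * B"
      using int p0 by (simp add: H_def B_def distrib_left mult.assoc)
    also have "\<dots> \<le> C * (l powr (q / p) * A) + C * l powr (q / p - 1) * B"
      using C G by (intro add_right_mono mult_left_mono) auto
    also have "\<dots> < \<epsilon> / 2 + \<epsilon> / 2"
    proof -
      have "B < \<epsilon> / (2 * C * l powr (q / p - 1))"
        using gd unfolding B_def \<delta>_def by simp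
      then have "C * l powr (q / p - 1) * B < \<epsilon> / 2"
        using C l by (simp add: field_simps)
      then show ?thesis using lA by simp
    qed
    finally show ?thesis using ST[OF g] by (intro bexI[of _ "\<lambda>x. signed_powr (p / q) (g x)"]) auto
  qed
  then show ?thesis using T pq by (simp add: dense_in_Lp_iff)
qed

lemma besov_space_dense_mono:
  assumes "heat_semigroup M \<E> \<F> P" "heat_kernel M P \<kappa>" "1 \<le> q" "q \<le> p"
    and "dense_in_Lp M p (besov_space M \<kappa> p \<alpha>)"
  shows "dense_in_Lp M q (besov_space M \<kappa> q \<alpha>)"
  using assms(3-5)
proof (rule signed_powr_dense)
  show "besov_space M \<kappa> q \<alpha> \<subseteq> Lp M q" by (auto simp: besov_space_def)
qed (rule signed_powr_besov_space[OF assms(1-4)])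

section \<open>The exponent 2\<close>

text \<open>By midpoint convexity, decrements over consecutive steps of length t do not increase.
  The last of n + 1 such decrements is therefore at most their average, and their telescoping sum is
  at most \<psi>(0).\<close>

lemma convex_decrement_le:
  fixes \<psi> :: "real \<Rightarrow> real"
  assumes nonneg: "\<And>x. 0 \<le> x \<Longrightarrow> 0 \<le> \<psi> x"
    and anti: "\<And>x. 0 \<le> x \<Longrightarrow> \<psi> x \<le> \<psi> 0"
    and midpoint: "\<And>x h. 0 \<le> x \<Longrightarrow> 0 \<le> h \<Longrightarrow> 2 * \<psi> (x + h) \<le> \<psi> x + \<psi> (x + 2 * h)"
    and "0 < s" "0 < t"
  shows "\<psi> s - \<psi> (s + t) \<le> \<psi> 0 / s * t"
proof -
  \<comment> \<open>The grid with step t is aligned so that \<open>s\<close> is its point number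
    \<open>n\<close>, with the remainder \<open>x0\<close> as starting point. Then x0 is
    non-negative, and n + 1 exceeds s/t, which gives the factor t/s.\<close>
  define n where "n = nat \<lfloor>s / t\<rfloor>"
  define x0 where "x0 = s - real n * t"
  define c where "c k = \<psi> (x0 + real k * t)" for k :: nat
  have n: "real n \<le> s / t" "s / t < real n + 1"
    using assms unfolding n_def by (auto simp: of_nat_nat)
  have x0: "0 \<le> x0"
    using n assms by (simp add: x0_def field_simps)
  have step: "c (Suc k) - c (Suc (Suc k)) \<le> c k - c (Suc k)" for k
    using midpoint[of "x0 + real k * t" t] x0 assms by (simp add: c_def algebra_simps)
  have "real (Suc k) * (c k - c (Suc k)) \<le> c 0 - c (Suc k)" for k
  proof (induction k)
    case 0
    show ?case by simp
  next
    case (Suc k)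
    have "real (Suc k) * (c (Suc k) - c (Suc (Suc k))) \<le> real (Suc k) * (c k - c (Suc k))"
      by (intro mult_left_mono step) simp
    then show ?case using Suc by (simp add: algebra_simps)
  qed
  from this[of n] have "(real n + 1) * (\<psi> s - \<psi> (s + t)) \<le> \<psi> x0 - \<psi> (s + t)"
    by (simp add: c_def x0_def algebra_simps)
  also have "\<dots> \<le> \<psi> 0"
  proof -
    have "0 \<le> \<psi> (s + t)"
      using assms by (intro nonneg) auto
    with anti[OF x0] show ?thesis by simp
  qed
  finally have *: "(real n + 1) * (\<psi> s - \<psi> (s + t)) \<le> \<psi> 0" .
  show ?thesis
  \<comment> \<open>Lowering the factor n + 1 to s/t is legitimate only for a positive decrement;
    otherwise the non-negative right side settles the claim.\<close>
  proof (cases "\<psi> s - \<psi> (s + t) \<le> 0")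
    case True
    then show ?thesis using nonneg[of 0] assms by (smt (verit) divide_nonneg_pos mult_nonneg_nonneg)
  next
    case False
    then have "s / t * (\<psi> s - \<psi> (s + t)) \<le> (real n + 1) * (\<psi> s - \<psi> (s + t))"
      using n by (intro mult_right_mono) auto
    with * have "s / t * (\<psi> s - \<psi> (s + t)) \<le> \<psi> 0" by linarith
    then show ?thesis using assms by (simp add: field_simps)
  qed
qed

section \<open>The heat semigroup and its energy on \<open>L\<^sup>2\<close>\<close>

lemma Lp_2_iff: "f \<in> Lp M 2 \<longleftrightarrow> f \<in> borel_measurable M \<and> integrable M (\<lambda>x. (f x)\<^sup>2)"
  by (simp add: Lp_def powr_numeral)

lemma Lp_2_mult_integrable:
  assumes "f \<in> Lp M 2" "g \<in> Lp M 2"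
  shows "integrable M (\<lambda>x. f x * g x)"
proof (rule Bochner_Integration.integrable_bound)
  show "integrable M (\<lambda>x. (f x)\<^sup>2 + (g x)\<^sup>2)"
    using assms by (auto simp: Lp_2_iff)
  show "(\<lambda>x. f x * g x) \<in> borel_measurable M"
    using assms by (auto simp: Lp_2_iff)
  show "AE x in M. norm (f x * g x) \<le> norm ((f x)\<^sup>2 + (g x)\<^sup>2)"
  proof (rule AE_I2)
    fix x
    have "\<bar>f x * g x\<bar> \<le> (f x)\<^sup>2 + (g x)\<^sup>2"
      using sum_squares_bound[of "f x" "g x"] sum_squares_bound[of "- f x" "g x"]
      by (auto simp: abs_le_iff algebra_simps)
    then show "norm (f x * g x) \<le> norm ((f x)\<^sup>2 + (g x)\<^sup>2)" by simp
  qed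
qed

lemma Lp_2_bounded:
  assumes "f \<in> Lp M 2" "g \<in> borel_measurable M" "\<And>x. \<bar>g x\<bar> \<le> \<bar>f x\<bar>"
  shows "g \<in> Lp M 2"
  unfolding Lp_2_iff
proof
  show "integrable M (\<lambda>x. (g x)\<^sup>2)"
  proof (rule Bochner_Integration.integrable_bound)
    show "integrable M (\<lambda>x. (f x)\<^sup>2)" using assms by (auto simp: Lp_2_iff)
    show "AE x in M. norm ((g x)\<^sup>2) \<le> norm ((f x)\<^sup>2)"
      using assms(3) by (auto intro!: AE_I2 simp: abs_le_square_iff)
  qed (use assms in auto)
qed fact

lemma heat_semigroup_Lp_2D:
  assumes "heat_semigroup M \<E> \<F> P"
  shows "\<And>t f. 0 \<le> t \<Longrightarrow> f \<in> Lp M 2 \<Longrightarrow> P t f \<in> Lp M 2"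
    and "\<And>t f. 0 \<le> t \<Longrightarrow> f \<in> Lp M 2 \<Longrightarrow> Lp_norm M 2 (P t f) \<le> Lp_norm M 2 f"
    and "\<And>t f g a b. 0 \<le> t \<Longrightarrow> f \<in> Lp M 2 \<Longrightarrow> g \<in> Lp M 2 \<Longrightarrow>
      AE x in M. P t (\<lambda>y. a * f y + b * g y) x = a * P t f x + b * P t g x"
    and "\<And>f. f \<in> Lp M 2 \<Longrightarrow> AE x in M. P 0 f x = f x"
    and "\<And>s t f. 0 \<le> s \<Longrightarrow> 0 \<le> t \<Longrightarrow> f \<in> Lp M 2 \<Longrightarrow> AE x in M. P (s + t) f x = P s (P t f) x"
    and "\<And>t f g. 0 \<le> t \<Longrightarrow> f \<in> Lp M 2 \<Longrightarrow> g \<in> Lp M 2 \<Longrightarrow>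
      (\<integral>x. P t f x * g x \<partial>M) = (\<integral>x. f x * P t g x \<partial>M)"
    and "\<And>f. f \<in> Lp M 2 \<Longrightarrow> ((\<lambda>t. Lp_norm M 2 (\<lambda>x. P t f x - f x)) \<longlongrightarrow> 0) (at_right 0)"
    and "\<And>t f. 0 \<le> t \<Longrightarrow> f \<in> Lp M 2 \<Longrightarrow> AE x in M. 0 \<le> f x \<and> f x \<le> 1 \<Longrightarrow>
      AE x in M. 0 \<le> P t f x \<and> P t f x \<le> 1"
proof -
  have "contraction_semigroup_Lp M 2 P"
    using assms unfolding heat_semigroup_def by (elim conjE)
  then have cont: "linear_semigroup_on M (Lp M 2) P"
    "\<forall>t\<ge>0. \<forall>f\<in>Lp M 2. Lp_norm M 2 (P t f) \<le> Lp_norm M 2 f"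
    unfolding contraction_semigroup_Lp_def by simp_all
  note lin = cont(1)[unfolded linear_semigroup_on_def]
  show "P t f \<in> Lp M 2" if "0 \<le> t" "f \<in> Lp M 2" for t f
    using lin that by simp
  show "Lp_norm M 2 (P t f) \<le> Lp_norm M 2 f" if "0 \<le> t" "f \<in> Lp M 2" for t f
    using cont(2) that by simp
  show "AE x in M. P t (\<lambda>y. a * f y + b * g y) x = a * P t f x + b * P t g x"
    if "0 \<le> t" "f \<in> Lp M 2" "g \<in> Lp M 2" for t f g a b
    using lin that by simp
  show "AE x in M. P 0 f x = f x" if "f \<in> Lp M 2" for f
    using lin that by simp
  show "AE x in M. P (s + t) f x = P s (P t f) x" if "0 \<le> s" "0 \<le> t" "f \<in> Lp M 2" for s t f
    using lin that by simp
  note heat = assms[unfolded heat_semigroup_def]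
  show "(\<integral>x. P t f x * g x \<partial>M) = (\<integral>x. f x * P t g x \<partial>M)"
    if "0 \<le> t" "f \<in> Lp M 2" "g \<in> Lp M 2" for t f g
    using heat that by (elim conjE) simp
  show "((\<lambda>t. Lp_norm M 2 (\<lambda>x. P t f x - f x)) \<longlongrightarrow> 0) (at_right 0)" if "f \<in> Lp M 2" for f
    using heat that by (elim conjE) simp
  show "AE x in M. 0 \<le> P t f x \<and> P t f x \<le> 1"
    if "0 \<le> t" "f \<in> Lp M 2" "AE x in M. 0 \<le> f x \<and> f x \<le> 1" for t f
    using heat that by (elim conjE) simp
qed

text \<open>The sub-Markov property speaks only of functions between 0 and 1, so an unbounded
  \<open>f\<close> is treated by duality. By self-adjointness, pairing \<open>P t f\<close> with a
  test function \<open>g\<close> in that range equals pairing \<open>f\<close> with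
  \<open>P t g\<close>, which is non-negative; if \<open>g\<close> lives where \<open>P t f\<close>
  is negative, the product must vanish almost everywhere.\<close>

lemma heat_semigroup_nonneg:
  assumes heat: "heat_semigroup M \<E> \<F> P" and t: "0 \<le> t" and f: "f \<in> Lp M 2"
    and nonneg: "\<And>x. 0 \<le> f x"
  shows "AE x in M. 0 \<le> P t f x"
proof -
  have Pf: "P t f \<in> Lp M 2"
    using heat t f by (rule heat_semigroup_Lp_2D)
  note [measurable] = LpD(1)[OF Pf]
  \<comment> \<open>The negative part of \<open>P t f\<close>, truncated so that the sub-Markov property applies to it.\<close>
  define g where "g x = min 1 (max 0 (- P t f x))" for x
  have g: "g \<in> Lp M 2"
    by (rule Lp_2_bounded[OF Pf]) (auto simp: g_def[abs_def])
  then have Pg: "P t g \<in> Lp M 2"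
    by (rule heat_semigroup_Lp_2D(1)[OF heat t])
  have "AE x in M. 0 \<le> g x \<and> g x \<le> 1" by (auto simp: g_def)
  from heat t g this have Pg_nonneg: "AE x in M. 0 \<le> P t g x \<and> P t g x \<le> 1"
    by (rule heat_semigroup_Lp_2D)
  have "(\<integral>x. P t f x * g x \<partial>M) = (\<integral>x. f x * P t g x \<partial>M)"
    using heat t f g by (rule heat_semigroup_Lp_2D)
  moreover have "0 \<le> (\<integral>x. f x * P t g x \<partial>M)"
    using Pg_nonneg nonneg by (intro integral_nonneg_AE) auto
  moreover have neg: "P t f x * g x \<le> 0" for x
    by (auto simp: g_def min_def max_def mult_le_0_iff)
  then have "0 \<le> (\<integral>x. - (P t f x * g x) \<partial>M)"
    by (intro integral_nonneg_AE) auto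
  ultimately have "(\<integral>x. - (P t f x * g x) \<partial>M) = 0" by simp
  then have "AE x in M. - (P t f x * g x) = 0"
    using Lp_2_mult_integrable[OF Pf g] neg by (subst (asm) integral_nonneg_eq_0_iff_AE) auto
  then show ?thesis
    by (rule AE_mp) (auto simp: g_def min_def max_def split: if_splits intro!: AE_I2)
qed

text \<open>The kernel formula is available for non-negative functions in L^2, so it is applied to
  the positive and negative parts. Both kernel integrals are finite almost everywhere, being values
  of \<open>P t\<close>, and may be subtracted.\<close>

lemma heat_kernel_integral_Lp_2:
  assumes heat: "heat_semigroup M \<E> \<F> P" "heat_kernel M P \<kappa>" and t: "0 \<le> t"
    and u: "u \<in> Lp M 2"
  shows "AE y in M. integrable (\<kappa> t y) u \<and> (\<integral>x. u x \<partial>\<kappa> t y) = P t u y"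
proof -
  define a b where "a x = max 0 (u x)" and "b x = max 0 (- u x)" for x
  note [measurable] = LpD(1)[OF u]
  have k: "\<kappa> t \<in> measurable M (prob_algebra M)"
    using heat(2) t unfolding heat_kernel_def by auto
  have ab: "a \<in> Lp M 2" "b \<in> Lp M 2"
    by (rule Lp_2_bounded[OF u]; auto simp: a_def[abs_def] b_def[abs_def])+
  have repr: "AE y in M. integrable (\<kappa> t y) f \<and> (\<integral>x. f x \<partial>\<kappa> t y) = P t f y"
    if f: "f \<in> Lp M 2" and nonneg: "\<And>x. 0 \<le> f x" for f
  proof -
    have "AE y in M. ennreal (P t f y) = (\<integral>\<^sup>+x. ennreal (f x) \<partial>\<kappa> t y)"
      using heat(2) t f nonneg by (intro heat_kernel_nn_integral[where p = 2]) auto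
    with heat_semigroup_nonneg[OF heat(1) t f nonneg] AE_space show ?thesis
    proof eventually_elim
      case (elim y)
      have [measurable]: "f \<in> borel_measurable (\<kappa> t y)"
        using LpD(1)[OF f] kernel_sets(1)[OF k elim(2)] by (simp cong: measurable_cong_sets)
      have "integrable (\<kappa> t y) f"
        by (rule integrableI_nonneg) (use nonneg in \<open>auto simp: elim(3)[symmetric]\<close>)
      moreover have "(\<integral>x. f x \<partial>\<kappa> t y) = enn2real (\<integral>\<^sup>+x. ennreal (f x) \<partial>\<kappa> t y)"
        using nonneg by (intro integral_eq_nn_integral) auto
      \<comment> \<open>Going back from \<open>ennreal\<close> to the reals recovers
        \<open>P t f y\<close> only because it is non-negative, which is
        \<open>elim(1)\<close>.\<close>
      then have "(\<integral>x. f x \<partial>\<kappa> t y) = P t f y"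
        unfolding elim(3)[symmetric] using elim(1) by simp
      ultimately show ?case by simp
    qed
  qed
  have "AE y in M. P t (\<lambda>x. 1 * a x + (- 1) * b x) y = 1 * P t a y + (- 1) * P t b y"
    using heat(1) t ab by (rule heat_semigroup_Lp_2D)
  moreover have "(\<lambda>x. 1 * a x + (- 1) * b x) = u"
    by (auto simp: a_def b_def max_def)
  ultimately have lin: "AE y in M. P t u y = P t a y - P t b y" by simp
  have u_eq: "u = (\<lambda>x. a x - b x)" by (auto simp: a_def b_def max_def)
  have "0 \<le> a x" "0 \<le> b x" for x by (auto simp: a_def b_def)
  with repr ab have "AE y in M. integrable (\<kappa> t y) a \<and> (\<integral>x. a x \<partial>\<kappa> t y) = P t a y"
    "AE y in M. integrable (\<kappa> t y) b \<and> (\<integral>x. b x \<partial>\<kappa> t y) = P t b y" by blast+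
  with lin show ?thesis
  proof eventually_elim
    case (elim y)
    then have "integrable (\<kappa> t y) (\<lambda>x. a x - b x)"
      "(\<integral>x. a x - b x \<partial>\<kappa> t y) = P t u y" by auto
    then show ?case by (simp flip: u_eq)
  qed
qed

text \<open>Expanding the square, the inner integral is P_t(u^2) - 2 u P_t u + u^2 at y. Integrating
  over \<open>M\<close>, the L^1 contraction bounds the first term by the integral of u^2.\<close>

lemma heat_energy_2_le:
  assumes heat: "heat_semigroup M \<E> \<F> P" "heat_kernel M P \<kappa>" and t: "0 \<le> t"
    and u: "u \<in> Lp M 2"
  shows "heat_energy M (\<kappa> t) 2 u \<le> ennreal (2 * ((\<integral>x. (u x)\<^sup>2 \<partial>M) - (\<integral>x. P t u x * u x \<partial>M)))"
proof -
  define f where "f = (\<lambda>x. (u x)\<^sup>2)"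
  have k: "\<kappa> t \<in> measurable M (prob_algebra M)"
    using heat(2) t unfolding heat_kernel_def by auto
  have f: "f \<in> Lp M 1"
    using u by (auto simp: Lp_2_iff f_def Lp_def)
  have cont: "contraction_semigroup_Lp M 1 P"
    using heat(1) unfolding heat_semigroup_def by auto
  then have Pf: "P t f \<in> Lp M 1" "Lp_norm M 1 (P t f) \<le> Lp_norm M 1 f"
    using t f unfolding contraction_semigroup_Lp_def linear_semigroup_on_def by auto
  have Pu: "P t u \<in> Lp M 2" by (rule heat_semigroup_Lp_2D(1)[OF heat(1) t u])
  \<comment> \<open>The absolute value is taken because u^2 is only known to lie in L^1, whereas
    positivity of \<open>P t\<close> was derived on L^2.\<close>
  define R where "R y = \<bar>P t f y\<bar> - 2 * (P t u y * u y) + (u y)\<^sup>2" for y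
  have "AE y in M. ennreal (P t f y) = (\<integral>\<^sup>+x. ennreal (f x) \<partial>\<kappa> t y)"
    using heat(2) t f by (intro heat_kernel_nn_integral[where p = 1]) (auto simp: f_def)
  with heat_kernel_integral_Lp_2[OF heat t u] AE_space
  have R: "AE y in M. (\<integral>\<^sup>+x. ennreal (\<bar>u x - u y\<bar> powr 2) \<partial>\<kappa> t y) \<le> ennreal (R y) \<and> 0 \<le> R y"
  proof eventually_elim
    case (elim y)
    interpret prob_space "\<kappa> t y" by (rule kernel_sets(3)[OF k elim(2)])
    have [measurable]: "u \<in> borel_measurable (\<kappa> t y)"
      using LpD(1)[OF u] kernel_sets(1)[OF k elim(2)] by (simp cong: measurable_cong_sets)
    have [measurable]: "f \<in> borel_measurable (\<kappa> t y)" by (simp add: f_def)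
    have nn: "(\<integral>\<^sup>+x. ennreal (f x) \<partial>\<kappa> t y) = ennreal (P t f y)" using elim(3) by simp
    have int_f: "integrable (\<kappa> t y) f"
      using nn by (intro integrableI_nonneg) (auto simp: f_def)
    have "(\<integral>x. f x \<partial>\<kappa> t y) = enn2real (ennreal (P t f y))"
      unfolding nn[symmetric] by (intro integral_eq_nn_integral) (auto simp: f_def)
    \<comment> \<open>A negative value of \<open>P t f y\<close> would be truncated to 0 by
      \<open>ennreal\<close>, which the absolute value still dominates.\<close>
    then have le: "(\<integral>x. f x \<partial>\<kappa> t y) \<le> \<bar>P t f y\<bar>"
      by (cases "0 \<le> P t f y") (auto simp: ennreal_neg)
    have sq: "(\<lambda>x. (u x - u y)\<^sup>2) = (\<lambda>x. f x - 2 * u y * u x + (u y)\<^sup>2)"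
      by (auto simp: f_def power2_eq_square algebra_simps)
    have int: "integrable (\<kappa> t y) (\<lambda>x. (u x - u y)\<^sup>2)"
      unfolding sq using elim(1) int_f by auto
    have "(\<integral>x. (u x - u y)\<^sup>2 \<partial>\<kappa> t y) = (\<integral>x. f x \<partial>\<kappa> t y) - 2 * (P t u y * u y) + (u y)\<^sup>2"
      unfolding sq using elim(1) int_f prob_space by simp
    with le have le_R: "(\<integral>x. (u x - u y)\<^sup>2 \<partial>\<kappa> t y) \<le> R y" by (simp add: R_def)
    have "(\<integral>\<^sup>+x. ennreal (\<bar>u x - u y\<bar> powr 2) \<partial>\<kappa> t y) = ennreal (\<integral>x. (u x - u y)\<^sup>2 \<partial>\<kappa> t y)"
      using int by (simp add: powr_numeral nn_integral_eq_integral)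
    moreover have "0 \<le> (\<integral>x. (u x - u y)\<^sup>2 \<partial>\<kappa> t y)" by simp
    ultimately show ?case using le_R by (metis ennreal_leI order_trans)
  qed
  have int: "integrable M (\<lambda>y. \<bar>P t f y\<bar>)" "integrable M (\<lambda>y. P t u y * u y)"
    "integrable M (\<lambda>y. (u y)\<^sup>2)"
    using LpD(2)[OF Pf(1)] Lp_2_mult_integrable[OF Pu u] u by (auto simp: Lp_2_iff)
  have "heat_energy M (\<kappa> t) 2 u \<le> (\<integral>\<^sup>+y. ennreal (R y) \<partial>M)"
    unfolding heat_energy_def using R by (intro nn_integral_mono_AE) auto
  also have "\<dots> = ennreal (\<integral>y. R y \<partial>M)"
    using int R by (intro nn_integral_eq_integral) (auto simp: R_def[abs_def])
  also have "(\<integral>y. R y \<partial>M) = (\<integral>y. \<bar>P t f y\<bar> \<partial>M) - 2 * (\<integral>y. P t u y * u y \<partial>M) + (\<integral>y. (u y)\<^sup>2 \<partial>M)"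
    unfolding R_def using int by simp
  also have "(\<integral>y. \<bar>P t f y\<bar> \<partial>M) \<le> (\<integral>y. (u y)\<^sup>2 \<partial>M)"
    using Pf(2) by (simp add: Lp_norm_def f_def)
  finally show ?thesis by (simp add: ennreal_leI)
qed

lemma heat_semigroup_besov_space:
  assumes heat: "heat_semigroup M \<E> \<F> P" "heat_kernel M P \<kappa>" and s: "0 < s"
    and g: "g \<in> Lp M 2"
  shows "P s g \<in> besov_space M \<kappa> 2 (1 / 2)"
proof -
  note P = heat_semigroup_Lp_2D[OF heat(1)]
  define \<psi> where "\<psi> t = (\<integral>x. P t g x * g x \<partial>M)" for t
  \<comment> \<open>Convexity of \<open>\<psi>\<close> replaces the spectral theorem: it makes \<open>\<psi>\<close> Lipschitz away from 0.\<close>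
  have L: "P a g \<in> Lp M 2" if "0 \<le> a" for a using P(1)[OF that g] .
  \<comment> \<open>Self-adjointness and the semigroup law make the pairing depend on a + b alone.
    Norms, cross terms and energies of the orbit of \<open>g\<close> all become values of
    \<psi>.\<close>
  have inner: "(\<integral>x. P a g x * P b g x \<partial>M) = \<psi> (a + b)" if "0 \<le> a" "0 \<le> b" for a b
  proof -
    have "(\<integral>x. P a g x * P b g x \<partial>M) = (\<integral>x. g x * P a (P b g) x \<partial>M)"
      by (rule P(6)[OF that(1) g L[OF that(2)]])
    also have "\<dots> = \<psi> (a + b)"
      unfolding \<psi>_def
    proof (rule integral_cong_AE)
      show "AE x in M. g x * P a (P b g) x = P (a + b) g x * g x"
        using P(5)[OF that g] by eventually_elim simp
    qed (use LpD(1)[OF g] LpD(1)[OF L, of "a + b"] LpD(1)[OF P(1)[OF that(1) L[OF that(2)]]] that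
        in \<open>auto intro: borel_measurable_times\<close>)
    finally show ?thesis .
  qed
  have square: "(\<integral>x. (P a g x)\<^sup>2 \<partial>M) = \<psi> (2 * a)" if "0 \<le> a" for a
    using inner[OF that that] by (simp add: power2_eq_square)
  have nonneg: "0 \<le> \<psi> x" if "0 \<le> x" for x
  proof -
    have "0 \<le> (\<integral>y. (P (x / 2) g y)\<^sup>2 \<partial>M)" by simp
    with square[of "x / 2"] that show ?thesis by simp
  qed
  have norm: "Lp_norm M 2 f = sqrt (\<integral>x. (f x)\<^sup>2 \<partial>M)" for f
    by (simp add: Lp_norm_def powr_numeral powr_half_sqrt)
  have "AE x in M. P 0 g x = g x" by (rule P(4)[OF g])
  then have zero: "(\<integral>x. (g x)\<^sup>2 \<partial>M) = \<psi> 0"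
    unfolding \<psi>_def using LpD(1)[OF g] LpD(1)[OF L, of 0]
    by (intro integral_cong_AE) (auto simp: power2_eq_square)
  have anti: "\<psi> x \<le> \<psi> 0" if "0 \<le> x" for x
    using P(2)[OF _ g, of "x / 2"] square[of "x / 2"] that by (simp add: norm zero)
  have midpoint: "2 * \<psi> (x + h) \<le> \<psi> x + \<psi> (x + 2 * h)" if "0 \<le> x" "0 \<le> h" for x h
  proof -
    \<comment> \<open>Halving the times makes \<psi>(x) and \<psi>(x + 2h) the squared norms of
      \<open>a\<close> and \<open>b\<close>, and \<psi>(x + h) their inner product; convexity is
      then the non-negativity of the squared norm of a - b.\<close>
    define a b where "a = P (x / 2) g" and "b = P (x / 2 + h) g"
    have ab: "a \<in> Lp M 2" "b \<in> Lp M 2" using L that by (auto simp: a_def b_def)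
    have "0 \<le> (\<integral>y. (a y - b y)\<^sup>2 \<partial>M)" by simp
    also have "(\<lambda>y. (a y - b y)\<^sup>2) = (\<lambda>y. (a y)\<^sup>2 + (b y)\<^sup>2 - 2 * (a y * b y))"
      by (auto simp: power2_eq_square algebra_simps)
    also have "(\<integral>y. (a y)\<^sup>2 + (b y)\<^sup>2 - 2 * (a y * b y) \<partial>M)
        = (\<integral>y. (a y)\<^sup>2 \<partial>M) + (\<integral>y. (b y)\<^sup>2 \<partial>M) - 2 * (\<integral>y. a y * b y \<partial>M)"
      using ab Lp_2_mult_integrable[OF ab] by (simp add: Lp_2_iff)
    also have "\<dots> = \<psi> x + \<psi> (x + 2 * h) - 2 * \<psi> (x + h)"
      using that by (simp add: a_def b_def square inner algebra_simps)
    finally show ?thesis by simp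
  qed
  have "heat_energy M (\<kappa> t) 2 (P s g) \<le> ennreal (\<psi> 0 / s * t powr (1 / 2 * 2))" if t: "0 < t" for t
  proof -
    have Ps: "P s g \<in> Lp M 2" using L s by simp
    have "(\<integral>x. P t (P s g) x * P s g x \<partial>M) = (\<integral>x. P (t + s) g x * P s g x \<partial>M)"
    proof (rule integral_cong_AE)
      show "AE x in M. P t (P s g) x * P s g x = P (t + s) g x * P s g x"
        using P(5)[of t s g] t s g by auto
    qed (use LpD(1)[OF Ps] LpD(1)[OF L, of "t + s"] LpD(1)[OF P(1)[OF _ Ps, of t]] t s
        in \<open>auto intro: borel_measurable_times\<close>)
    also have "\<dots> = \<psi> (2 * s + t)" using inner[of "t + s" s] t s by (simp add: algebra_simps)
    finally have "heat_energy M (\<kappa> t) 2 (P s g) \<le> ennreal (2 * (\<psi> (2 * s) - \<psi> (2 * s + t)))"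
      using heat_energy_2_le[OF heat _ Ps, of t] square[of s] t s by simp
    \<comment> \<open>The decrement bound is used at the point 2s, so the factor 2 of the energy
      estimate cancels.\<close>
    also have "\<dots> \<le> ennreal (2 * (\<psi> 0 / (2 * s) * t))"
      using convex_decrement_le[of \<psi> "2 * s" t, OF nonneg anti midpoint] t s
      by (intro ennreal_leI mult_left_mono) auto
    finally show ?thesis using t by simp
  qed
  then show ?thesis
    using L[of s] s nonneg[of 0] by (auto simp: besov_space_iff intro!: exI[of _ "\<psi> 0 / s"])
qed

text \<open>Strong continuity at 0 makes P_s f converge to f in L^2 as s decreases to 0, and every
  P_s f with s > 0 lies in the Besov space.\<close>

lemma besov_space_2_dense:
  assumes heat: "heat_semigroup M \<E> \<F> P" "heat_kernel M P \<kappa>"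
  shows "dense_in_Lp M 2 (besov_space M \<kappa> 2 (1 / 2))"
  unfolding dense_in_Lp_def
proof (intro conjI ballI allI impI)
  show "besov_space M \<kappa> 2 (1 / 2) \<subseteq> Lp M 2" by (auto simp: besov_space_def)
next
  fix f \<epsilon> assume f: "f \<in> Lp M 2" and "0 < (\<epsilon> :: real)"
  have "eventually (\<lambda>s. Lp_norm M 2 (\<lambda>x. P s f x - f x) < \<epsilon>) (at_right 0)"
    using heat_semigroup_Lp_2D(7)[OF heat(1) f] \<open>0 < \<epsilon>\<close> by (rule order_tendstoD)
  moreover have "eventually (\<lambda>s. 0 < (s :: real)) (at_right 0)"
    by (rule eventually_at_right_less)
  ultimately have "eventually (\<lambda>s. 0 < s \<and> Lp_norm M 2 (\<lambda>x. P s f x - f x) < \<epsilon>) (at_right 0)"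
    by eventually_elim simp
  then obtain s where s: "0 < s" "Lp_norm M 2 (\<lambda>x. P s f x - f x) < \<epsilon>"
    using eventually_happens[of _ "at_right (0 :: real)"] by auto
  have "Lp_norm M 2 (\<lambda>x. f x - P s f x) < \<epsilon>"
    using s(2) by (simp add: Lp_norm_def abs_minus_commute)
  then show "\<exists>g\<in>besov_space M \<kappa> 2 (1 / 2). Lp_norm M 2 (\<lambda>x. f x - g x) < \<epsilon>"
    using heat_semigroup_besov_space[OF heat s(1) f] by blast
qed

theorem corollary4p8:
  fixes M :: "'a measure"
    and \<E> :: "('a \<Rightarrow> real) \<Rightarrow> ('a \<Rightarrow> real) \<Rightarrow> real"
    and \<F> :: "('a \<Rightarrow> real) set"
    and P :: "real \<Rightarrow> ('a \<Rightarrow> real) \<Rightarrow> 'a \<Rightarrow> real"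
    and \<kappa> :: "real \<Rightarrow> 'a \<Rightarrow> 'a measure"
    and \<alpha> :: real
  assumes "dirichlet_space M \<E> \<F>"
    and "heat_semigroup M \<E> \<F> P"
    and "conservative M P"
    and "heat_kernel M P \<kappa>"
    and "\<alpha> \<ge> 0"
  shows "(\<forall>p q. 1 \<le> q \<and> q \<le> p \<and> dense_in_Lp M p (besov_space M \<kappa> p \<alpha>) \<longrightarrow>
            dense_in_Lp M q (besov_space M \<kappa> q \<alpha>)) \<and>
         (\<forall>p. 1 \<le> p \<and> p \<le> 2 \<longrightarrow> dense_in_Lp M p (besov_space M \<kappa> p (1/2)))"
  \<comment> \<open>The second claim is the first mechanism at order 1/2, descending from exponent 2
    to p.\<close>
  using besov_space_dense_mono[OF assms(2,4)] besov_space_2_dense[OF assms(2,4)] by blast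

end
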